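(* Let $$F(W)=\frac12\sum_{i=1}^N\big\|\sigma\big(\mathrm{Mat}(u)\,g_i(v)\big)\big\|^2+\frac{\lambda_2}2\big(\|u\|^2+\|v\|^2\big),\qquad W=(u,v),\ u\in\mathbb{R}^{km},\ v\in\mathbb{R}^n,$$ where $g_i:\mathbb{R}^n\to\mathbb{R}^m$, $\sigma:\mathbb{R}\to\mathbb{R}$ is applied coordinate-wise, and $\mathrm{Mat}(u)\in\mathbb{R}^{k\times m}$. Suppose that $\sigma$ is twice differentiable and that $\sigma'$ and $\sigma\cdot\sigma''$ are globally bounded. Suppose that each $g_i$ is twice differentiable and that all partial derivatives of order zero, one and two of $g_i$ are globally bounded. Then, for any given $\delta>0$ and any $r\ge4$, the function $F$ is smooth adaptable with respect to $\phi(W)=\frac12\|W\|^2+\frac\delta r\|W\|^r$.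
   Context: $\mathrm{Mat}(u)$ reshapes the vector $u\in\mathbb{R}^{km}$ into a $k\times m$ matrix (inverse of column-order vectorization). $\lambda_2\ge0$ is a constant (weight decay coefficient). A function $F$ is smooth adaptable with respect to $\phi$ (on the whole space $\mathbb{R}^{km+n}$) if there exists $L>0$ such that $L\phi+F$ and $L\phi-F$ are both convex on $\mathbb{R}^{km+n}$. Norms are Euclidean. *)

theory Defs
  imports "HOL-Analysis.Analysis"
begin

text \<open>The vector space of dimension \<open>km\<close> is indexed by pairs (column, row). In lexicographic order
  these indices enumerate the entries of a \<open>k \<times> m\<close> matrix column by column, so \<open>Mat\<close> is the
  inverse of column-order vectorization.\<close>

definition Mat :: "real ^ ('m::finite \<times> 'k::finite) \<Rightarrow> real ^ 'm ^ 'k" where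
  "Mat u = (\<chi> a b. u $ (b, a))"

definition coordwise :: "(real \<Rightarrow> real) \<Rightarrow> real ^ 'k \<Rightarrow> real ^ 'k" where
  "coordwise \<sigma> x = (\<chi> a. \<sigma> (x $ a))"

definition objective ::
  "nat \<Rightarrow> (real \<Rightarrow> real) \<Rightarrow> (nat \<Rightarrow> real ^ 'n \<Rightarrow> real ^ 'm) \<Rightarrow> real
    \<Rightarrow> (real ^ ('m::finite \<times> 'k::finite)) \<times> (real ^ 'n::finite) \<Rightarrow> real" where
  "objective N \<sigma> g lam2 = (\<lambda>(u, v).
     1 / 2 * (\<Sum>i=1..N. (norm (coordwise \<sigma> (Mat u *v g i v)))\<^sup>2)
     + lam2 / 2 * ((norm u)\<^sup>2 + (norm v)\<^sup>2))"

text \<open>Since \<open>0 powr r = 0\<close>, the kernel below also has the intended value at the origin.\<close>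

definition poly_kernel :: "real \<Rightarrow> real \<Rightarrow> 'a::real_normed_vector \<Rightarrow> real" where
  "poly_kernel \<delta> r W = 1 / 2 * (norm W)\<^sup>2 + \<delta> / r * norm W powr r"

definition smooth_adaptable :: "('a::real_vector \<Rightarrow> real) \<Rightarrow> ('a \<Rightarrow> real) \<Rightarrow> bool" where
  "smooth_adaptable \<phi> F \<longleftrightarrow>
     (\<exists>L>0. convex_on UNIV (\<lambda>W. L * \<phi> W + F W) \<and> convex_on UNIV (\<lambda>W. L * \<phi> W - F W))"

text \<open>Twice Frechet differentiable everywhere; the second derivative is not assumed continuous.\<close>

definition twice_differentiable ::
  "('a::real_normed_vector \<Rightarrow> 'b::real_normed_vector) \<Rightarrow> bool" where
  "twice_differentiable f \<longleftrightarrow>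
     (\<forall>x. f differentiable (at x)) \<and>
     (\<forall>x. (\<lambda>y. Blinfun (frechet_derivative f (at y))) differentiable (at x))"

definition partial_deriv ::
  "'n::finite \<Rightarrow> (real ^ 'n \<Rightarrow> 'b::real_normed_vector) \<Rightarrow> real ^ 'n \<Rightarrow> 'b" where
  "partial_deriv j f x = vector_derivative (\<lambda>t. f (x + t *\<^sub>R axis j 1)) (at 0)"

end

theory Submission
  imports Defs
begin

text \<open>
  Convexity is tested along lines, where it amounts to a nonnegative second derivative, so the
  theorem compares second derivatives along lines \<open>t \<mapsto> W + t D\<close>.

  On the side of \<open>F\<close>, every coordinate \<open>s = \<Sum>\<^sub>b u\<^sub>b\<^sub>a g\<^sub>i(v)\<^sub>b\<close> of the vector \<open>Mat(u) g\<^sub>i(v)\<close> is linear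
  in \<open>u\<close> with coefficients that are bounded together with two derivatives. Hence \<open>s\<close>, \<open>s'\<close>, \<open>s''\<close> are of
  size at most a constant times \<open>1 + \<bar>W\<bar>\<close>. In
  \<open>(\<sigma>(s)\<^sup>2)'' = 2 ((\<sigma>'\<^sup>2 + \<sigma> \<sigma>'') s'\<^sup>2 + \<sigma> \<sigma>' s'')\<close> the factor \<open>\<sigma>'\<^sup>2 + \<sigma> \<sigma>''\<close> is bounded and
  \<open>\<sigma>(s)\<close> grows at most linearly in \<open>s\<close>, so the second derivative of \<open>F\<close> in direction \<open>D\<close> is bounded in
  absolute value by \<open>C (1 + \<bar>W\<bar>\<^sup>2) \<bar>D\<bar>\<^sup>2\<close> (lemma \<open>quadratic_hessian_activation_square\<close>).

  The quartic kernel \<open>\<bar>W\<bar>\<^sup>2/2 + \<bar>W\<bar>\<^sup>4/4\<close> has second derivative at least \<open>(1 + \<bar>W\<bar>\<^sup>2) \<bar>D\<bar>\<^sup>2\<close>, so a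
  multiple of it compensates \<open>F\<close> and \<open>-F\<close> (lemma \<open>quartic_kernel_dominates\<close>). Finally, the kernel
  \<open>\<phi>\<close> of exponent \<open>r \<ge> 4\<close> is a small multiple of the quartic kernel plus a convex
  function: their difference is a convex nondecreasing function of the norm (lemma
  \<open>poly_kernel_minus_quartic_kernel_convex\<close>). Passing through the quartic kernel confines real powers
  to a function of one real variable; along lines only polynomials have to be differentiated.
\<close>

section \<open>Functions whose Hessian grows at most quadratically\<close>

text \<open>The second derivative of \<open>f\<close> at \<open>W\<close> in direction \<open>D\<close> exists and is bounded in
  absolute value by \<open>C (1 + \<bar>W\<bar>\<^sup>2) \<bar>D\<bar>\<^sup>2\<close>. It is taken along lines only, which suffices for convexity and avoids
  second Frechet derivatives of compositions.\<close>

definition quadratic_hessian :: "real \<Rightarrow> ('a::real_normed_vector \<Rightarrow> real) \<Rightarrow> bool" where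
  "quadratic_hessian C f \<longleftrightarrow>
     (\<forall>W D. \<exists>f1 f2. \<forall>t. ((\<lambda>t. f (W + t *\<^sub>R D)) has_real_derivative f1 t) (at t) \<and>
        (f1 has_real_derivative f2 t) (at t) \<and>
        \<bar>f2 t\<bar> \<le> C * (1 + (norm (W + t *\<^sub>R D))\<^sup>2) * (norm D)\<^sup>2)"

lemma quadratic_hessian_add:
  assumes "quadratic_hessian C f" "quadratic_hessian C' h"
  shows "quadratic_hessian (C + C') (\<lambda>W. f W + h W)"
  unfolding quadratic_hessian_def
proof (intro allI)
  fix W D :: 'a
  from assms obtain f1 f2 h1 h2 where
    f: "\<And>t. ((\<lambda>t. f (W + t *\<^sub>R D)) has_real_derivative f1 t) (at t)"
       "\<And>t. (f1 has_real_derivative f2 t) (at t)"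
       "\<And>t. \<bar>f2 t\<bar> \<le> C * (1 + (norm (W + t *\<^sub>R D))\<^sup>2) * (norm D)\<^sup>2"
    and h: "\<And>t. ((\<lambda>t. h (W + t *\<^sub>R D)) has_real_derivative h1 t) (at t)"
       "\<And>t. (h1 has_real_derivative h2 t) (at t)"
       "\<And>t. \<bar>h2 t\<bar> \<le> C' * (1 + (norm (W + t *\<^sub>R D))\<^sup>2) * (norm D)\<^sup>2"
    unfolding quadratic_hessian_def by metis
  have "\<bar>f2 t + h2 t\<bar> \<le> (C + C') * (1 + (norm (W + t *\<^sub>R D))\<^sup>2) * (norm D)\<^sup>2" for t
    using f(3)[of t] h(3)[of t] unfolding distrib_right by linarith
  then show "\<exists>k1 k2. \<forall>t. ((\<lambda>t. f (W + t *\<^sub>R D) + h (W + t *\<^sub>R D)) has_real_derivative k1 t) (at t) \<and>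
        (k1 has_real_derivative k2 t) (at t) \<and>
        \<bar>k2 t\<bar> \<le> (C + C') * (1 + (norm (W + t *\<^sub>R D))\<^sup>2) * (norm D)\<^sup>2"
    by (intro exI[of _ "\<lambda>t. f1 t + h1 t"] exI[of _ "\<lambda>t. f2 t + h2 t"])
       (auto intro!: DERIV_add f h)
qed

lemma quadratic_hessian_cmult:
  assumes "quadratic_hessian C f"
  shows "quadratic_hessian (\<bar>a\<bar> * C) (\<lambda>W. a * f W)"
  unfolding quadratic_hessian_def
proof (intro allI)
  fix W D :: 'a
  from assms obtain f1 f2 where
    f: "\<And>t. ((\<lambda>t. f (W + t *\<^sub>R D)) has_real_derivative f1 t) (at t)"
       "\<And>t. (f1 has_real_derivative f2 t) (at t)"
       "\<And>t. \<bar>f2 t\<bar> \<le> C * (1 + (norm (W + t *\<^sub>R D))\<^sup>2) * (norm D)\<^sup>2"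
    unfolding quadratic_hessian_def by metis
  have "\<bar>a * f2 t\<bar> \<le> \<bar>a\<bar> * C * (1 + (norm (W + t *\<^sub>R D))\<^sup>2) * (norm D)\<^sup>2" for t
    using mult_left_mono[OF f(3)[of t], of "\<bar>a\<bar>"] by (simp add: abs_mult mult.assoc)
  then show "\<exists>k1 k2. \<forall>t. ((\<lambda>t. a * f (W + t *\<^sub>R D)) has_real_derivative k1 t) (at t) \<and>
        (k1 has_real_derivative k2 t) (at t) \<and>
        \<bar>k2 t\<bar> \<le> \<bar>a\<bar> * C * (1 + (norm (W + t *\<^sub>R D))\<^sup>2) * (norm D)\<^sup>2"
    by (intro exI[of _ "\<lambda>t. a * f1 t"] exI[of _ "\<lambda>t. a * f2 t"])
       (auto intro!: DERIV_cmult f)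
qed

lemma quadratic_hessian_sum:
  assumes "finite I" "\<And>i. i \<in> I \<Longrightarrow> \<exists>C. quadratic_hessian C (f i)"
  shows "\<exists>C. quadratic_hessian C (\<lambda>W. \<Sum>i\<in>I. f i W)"
  using assms
proof (induction rule: finite_induct)
  case empty
  have "quadratic_hessian 0 (\<lambda>W. 0)"
    unfolding quadratic_hessian_def
    by (intro allI exI[of _ "\<lambda>t. 0"]) auto
  then show ?case by auto
next
  case (insert i I)
  then obtain C C' where "quadratic_hessian C (f i)" "quadratic_hessian C' (\<lambda>W. \<Sum>i\<in>I. f i W)"
    by blast
  then have "quadratic_hessian (C + C') (\<lambda>W. f i W + (\<Sum>i\<in>I. f i W))"
    by (rule quadratic_hessian_add)
  with insert.hyps show ?case by auto
qed

lemma norm_square_line: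
  fixes W D :: "'a::real_inner"
  shows "(norm (W + t *\<^sub>R D))\<^sup>2 = (norm W)\<^sup>2 + 2 * (W \<bullet> D) * t + (norm D)\<^sup>2 * t\<^sup>2"
  unfolding power2_norm_eq_inner
  by (simp add: inner_simps inner_commute algebra_simps power2_eq_square)

lemma quadratic_hessian_norm_square: "quadratic_hessian 2 (\<lambda>W::'a::real_inner. (norm W)\<^sup>2)"
  unfolding quadratic_hessian_def norm_square_line
proof (intro allI)
  fix W D :: 'a
  have "2 * (norm D)\<^sup>2 \<le> 2 * (1 + ((norm W)\<^sup>2 + 2 * (W \<bullet> D) * t + (norm D)\<^sup>2 * t\<^sup>2)) * (norm D)\<^sup>2" for t
  proof -
    have "2 * 1 * (norm D)\<^sup>2 \<le> 2 * (1 + (norm (W + t *\<^sub>R D))\<^sup>2) * (norm D)\<^sup>2"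
      by (intro mult_right_mono mult_left_mono) auto
    then show ?thesis by (simp add: norm_square_line)
  qed
  then show "\<exists>f1 f2. \<forall>t.
     ((\<lambda>t. (norm W)\<^sup>2 + 2 * (W \<bullet> D) * t + (norm D)\<^sup>2 * t\<^sup>2) has_real_derivative f1 t) (at t) \<and>
     (f1 has_real_derivative f2 t) (at t) \<and>
     \<bar>f2 t\<bar> \<le> 2 * (1 + ((norm W)\<^sup>2 + 2 * (W \<bullet> D) * t + (norm D)\<^sup>2 * t\<^sup>2)) * (norm D)\<^sup>2"
    by (intro exI[of _ "\<lambda>t. 2 * (W \<bullet> D) + 2 * (norm D)\<^sup>2 * t"] exI[of _ "\<lambda>t. 2 * (norm D)\<^sup>2"])
       (auto intro!: derivative_eq_intros)
qed

section \<open>Domination by the quartic kernel\<close>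

text \<open>A kernel that is polynomial along lines and whose Hessian is bounded below by
  \<open>1 + \<bar>W\<bar>\<^sup>2\<close>.\<close>

definition quartic_kernel :: "'a::real_inner \<Rightarrow> real" where
  "quartic_kernel W = (norm W)\<^sup>2 / 2 + (norm W) ^ 4 / 4"

lemma convex_on_lines:
  fixes f :: "'a::real_vector \<Rightarrow> real"
  assumes "\<And>W D. convex_on UNIV (\<lambda>t. f (W + t *\<^sub>R D))"
  shows "convex_on UNIV f"
proof (rule convex_onI)
  fix t x y assume t: "0 < (t::real)" "t < 1"
  have "f (x + ((1 - t) *\<^sub>R 0 + t *\<^sub>R 1) *\<^sub>R (y - x))
      \<le> (1 - t) * f (x + 0 *\<^sub>R (y - x)) + t * f (x + 1 *\<^sub>R (y - x))"
    using convex_onD[OF assms[of x "y - x"], of t 0 1] t by simp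
  then show "f ((1 - t) *\<^sub>R x + t *\<^sub>R y) \<le> (1 - t) * f x + t * f y"
    by (simp add: algebra_simps)
qed simp

lemma quartic_kernel_dominates:
  fixes f :: "'a::real_inner \<Rightarrow> real"
  assumes "quadratic_hessian C f" "C \<le> M"
  shows "convex_on UNIV (\<lambda>W. M * quartic_kernel W + f W)"
proof (rule convex_on_lines)
  fix W D :: 'a
  obtain f1 f2 where
    f: "\<And>t. ((\<lambda>t. f (W + t *\<^sub>R D)) has_real_derivative f1 t) (at t)"
       "\<And>t. (f1 has_real_derivative f2 t) (at t)"
       "\<And>t. \<bar>f2 t\<bar> \<le> C * (1 + (norm (W + t *\<^sub>R D))\<^sup>2) * (norm D)\<^sup>2"
    using assms unfolding quadratic_hessian_def by metis
  define q where "q t = (norm (W + t *\<^sub>R D))\<^sup>2" for t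
  define q1 where "q1 t = 2 * (W \<bullet> D) + 2 * (norm D)\<^sup>2 * t" for t
  define q2 where "q2 = 2 * (norm D)\<^sup>2"
  have dq: "(q has_real_derivative q1 t) (at t)" for t
    unfolding q_def q1_def norm_square_line by (auto intro!: derivative_eq_intros)
  have dq1: "(q1 has_real_derivative q2) (at t)" for t
    unfolding q1_def q2_def by (auto intro!: derivative_eq_intros)
  have ker: "quartic_kernel (W + t *\<^sub>R D) = q t / 2 + (q t)\<^sup>2 / 4" for t
    by (simp add: quartic_kernel_def q_def flip: power_mult)
  \<comment> \<open>The second derivative of the kernel is \<open>(1 + q) \<bar>D\<bar>\<^sup>2 + q'\<^sup>2 / 2\<close>, whose first summand already
    absorbs that of \<open>f\<close>.\<close>
  show "convex_on UNIV (\<lambda>t. M * quartic_kernel (W + t *\<^sub>R D) + f (W + t *\<^sub>R D))"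
    unfolding ker
  proof (rule f''_ge0_imp_convex[where f' = "\<lambda>t. M * (q1 t * (1 + q t) / 2) + f1 t"
        and f'' = "\<lambda>t. M * ((q2 * (1 + q t) + (q1 t)\<^sup>2) / 2) + f2 t"])
    fix t
    show "((\<lambda>t. M * (q t / 2 + (q t)\<^sup>2 / 4) + f (W + t *\<^sub>R D)) has_real_derivative
        M * (q1 t * (1 + q t) / 2) + f1 t) (at t)"
      by (rule derivative_eq_intros dq f refl | simp add: algebra_simps)+
    show "((\<lambda>t. M * (q1 t * (1 + q t) / 2) + f1 t) has_real_derivative
        M * ((q2 * (1 + q t) + (q1 t)\<^sup>2) / 2) + f2 t) (at t)"
      by (rule derivative_eq_intros dq dq1 f refl | simp add: algebra_simps power2_eq_square)+
    have pos: "0 \<le> (1 + q t) * (norm D)\<^sup>2" by (simp add: q_def)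
    have C: "\<bar>f2 t\<bar> \<le> C * ((1 + q t) * (norm D)\<^sup>2)"
      using f(3)[of t] by (simp add: q_def mult.assoc)
    also have "\<dots> \<le> M * ((1 + q t) * (norm D)\<^sup>2)"
      by (rule mult_right_mono[OF assms(2) pos])
    finally have M: "\<bar>f2 t\<bar> \<le> M * ((1 + q t) * (norm D)\<^sup>2)" .
    show "0 \<le> M * ((q2 * (1 + q t) + (q1 t)\<^sup>2) / 2) + f2 t"
    proof (cases "D = 0")
      case True
      with M show ?thesis by (simp add: q2_def q1_def)
    next
      case False
      \<comment> \<open>\<open>C\<close> is not assumed nonnegative, but the bound forces \<open>M \<ge> 0\<close> as soon as \<open>D \<noteq> 0\<close>.\<close>
      then have "0 < (1 + q t) * (norm D)\<^sup>2" by (simp add: q_def add_pos_nonneg)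
      moreover have "0 \<le> M * ((1 + q t) * (norm D)\<^sup>2)" using M by linarith
      ultimately have "0 \<le> M" by (metis zero_le_mult_iff not_less)
      then have "0 \<le> M * (q1 t)\<^sup>2 / 2" by simp
      moreover have "M * ((q2 * (1 + q t) + (q1 t)\<^sup>2) / 2) = M * ((1 + q t) * (norm D)\<^sup>2) + M * (q1 t)\<^sup>2 / 2"
        unfolding q2_def by (simp add: field_simps)
      ultimately show ?thesis using M by linarith
    qed
  qed auto
qed

section \<open>Comparison of the two kernels\<close>

lemma convex_on_radial:
  fixes \<psi> :: "real \<Rightarrow> real"
  assumes "convex_on {0..} \<psi>" "mono_on {0..} \<psi>"
  shows "convex_on UNIV (\<lambda>W::'a::real_normed_vector. \<psi> (norm W))"
proof (rule convex_onI)
  fix t :: real and x y :: 'a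
  assume t: "0 < t" "t < 1"
  have "norm ((1 - t) *\<^sub>R x + t *\<^sub>R y) \<le> (1 - t) * norm x + t * norm y"
    using norm_triangle_ineq[of "(1 - t) *\<^sub>R x" "t *\<^sub>R y"] t by simp
  then have "\<psi> (norm ((1 - t) *\<^sub>R x + t *\<^sub>R y)) \<le> \<psi> ((1 - t) * norm x + t * norm y)"
    using t by (intro mono_onD[OF assms(2)]) auto
  also have "\<dots> \<le> (1 - t) * \<psi> (norm x) + t * \<psi> (norm y)"
    using convex_onD[OF assms(1), of t "norm x" "norm y"] t by simp
  finally show "\<psi> (norm ((1 - t) *\<^sub>R x + t *\<^sub>R y)) \<le> (1 - t) * \<psi> (norm x) + t * \<psi> (norm y)" .
qed simp

lemma square_le_one_plus_powr:
  fixes s r :: real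
  assumes "0 \<le> s" "4 \<le> r"
  shows "s\<^sup>2 \<le> 1 + s powr (r - 2)"
proof (cases "s \<le> 1")
  case True
  then have "s\<^sup>2 \<le> 1" using assms by (simp add: power_le_one)
  then show ?thesis by (simp add: add_increasing2)
next
  case False
  then have "s powr 2 \<le> s powr (r - 2)" using assms by (intro powr_mono) auto
  then show ?thesis using False by simp
qed

text \<open>The absolute value makes the power two-sided differentiable at \<open>0\<close>, the endpoint of the
  interval on which the radial profile below is studied.\<close>

lemma has_real_derivative_abs_powr:
  fixes x r :: real
  assumes "0 \<le> x" "2 < r"
  shows "((\<lambda>s. \<bar>s\<bar> powr r) has_real_derivative r * x powr (r - 1)) (at x)"
proof (cases "x = 0")
  case True
  \<comment> \<open>Caratheodory's criterion, with slope function \<open>z \<bar>z\<bar>\<^sup>r\<^sup>-\<^sup>2\<close>\<close>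
  have eq: "\<bar>z\<bar> powr r = z * \<bar>z\<bar> powr (r - 2) * z" for z :: real
  proof (cases "z = 0")
    case False
    have "\<bar>z\<bar> powr r = \<bar>z\<bar> powr (2 + (r - 2))" by simp
    also have "\<dots> = \<bar>z\<bar>\<^sup>2 * \<bar>z\<bar> powr (r - 2)" using False by (subst powr_add) simp
    finally show ?thesis by (simp add: power2_eq_square)
  qed simp
  have "((\<lambda>z. \<bar>z\<bar> powr (r - 2)) \<longlongrightarrow> \<bar>0\<bar> powr (r - 2)) (at (0::real))"
    using assms by (intro tendsto_powr' tendsto_intros) auto
  then have "isCont (\<lambda>z. z * \<bar>z\<bar> powr (r - 2)) 0"
    by (intro continuous_mult) (auto simp: isCont_def)
  then have "((\<lambda>s. \<bar>s\<bar> powr r) has_real_derivative 0) (at 0)"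
    unfolding CARAT_DERIV using eq by (intro exI[of _ "\<lambda>z. z * \<bar>z\<bar> powr (r - 2)"]) simp
  then show ?thesis using True by simp
next
  case False
  then have x: "0 < x" using assms by simp
  have "((\<lambda>s. s powr r) has_real_derivative r * x powr (r - 1)) (at x)"
    using x by (rule has_real_derivative_powr)
  then show ?thesis
    by (rule has_field_derivative_transform_within_open[of _ _ _ "{0<..}"]) (use x in auto)
qed

text \<open>The difference is \<open>\<psi>(\<bar>W\<bar>)\<close> for the profile \<open>\<psi>\<close> below. Since \<open>s\<^sup>2 \<le> 1 + s\<^sup>r\<^sup>-\<^sup>2\<close>, its second
  derivative \<open>(1 - c) - 3 c s\<^sup>2 + \<delta> (r - 1) s\<^sup>r\<^sup>-\<^sup>2\<close> is nonnegative when \<open>3 c \<le> 1 - c\<close> and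
  \<open>3 c \<le> \<delta>\<close>, which explains the bounds on \<open>c\<close>.\<close>

lemma poly_kernel_minus_quartic_kernel_convex:
  fixes \<delta> r c :: real
  assumes r: "4 \<le> r" and \<delta>: "0 < \<delta>" and c: "0 \<le> c" "c \<le> 1 / 4" "3 * c \<le> \<delta>"
  shows "convex_on UNIV (\<lambda>W::'a::real_inner. poly_kernel \<delta> r W - c * quartic_kernel W)"
proof -
  define \<psi> where "\<psi> s = (1 - c) / 2 * s\<^sup>2 - c / 4 * s ^ 4 + \<delta> / r * \<bar>s\<bar> powr r" for s :: real
  define \<psi>1 where "\<psi>1 s = (1 - c) * s - c * s ^ 3 + \<delta> * s powr (r - 1)" for s :: real
  have d0: "(\<psi> has_real_derivative \<psi>1 s) (at s)" if "0 \<le> s" for s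
  proof -
    have "((\<lambda>s. \<bar>s\<bar> powr r) has_real_derivative r * s powr (r - 1)) (at s)"
      using r that by (intro has_real_derivative_abs_powr) auto
    from DERIV_cmult[OF this, of "\<delta> / r"]
    have "((\<lambda>s. \<delta> / r * \<bar>s\<bar> powr r) has_real_derivative \<delta> * s powr (r - 1)) (at s)"
      using r by simp
    then show ?thesis
      unfolding \<psi>_def \<psi>1_def
      by (intro DERIV_add) (auto intro!: derivative_eq_intros simp: field_simps)
  qed
  have d1: "\<exists>d. (\<psi>1 has_real_derivative d) (at s) \<and> 0 \<le> d" if "0 < s" for s
  proof (intro exI conjI)
    show "(\<psi>1 has_real_derivative (1 - c) - 3 * c * s\<^sup>2 + \<delta> * ((r - 1) * s powr (r - 2))) (at s)"
      unfolding \<psi>1_def using that by (auto intro!: derivative_eq_intros)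
    have "3 * c * s\<^sup>2 \<le> 3 * c * (1 + s powr (r - 2))"
      using square_le_one_plus_powr[of s r] r c that by (intro mult_left_mono) auto
    moreover have "3 * c * s powr (r - 2) \<le> \<delta> * (r - 1) * s powr (r - 2)"
    proof (rule mult_right_mono)
      have "\<delta> * 1 \<le> \<delta> * (r - 1)" using r \<delta> by (intro mult_left_mono) auto
      then show "3 * c \<le> \<delta> * (r - 1)" using c by simp
    qed simp
    ultimately show "0 \<le> (1 - c) - 3 * c * s\<^sup>2 + \<delta> * ((r - 1) * s powr (r - 2))"
      using c by (simp add: algebra_simps)
  qed
  have nonneg: "0 \<le> \<psi>1 s" if "0 \<le> s" for s
  proof -
    have "c * s\<^sup>2 \<le> c * (1 + s powr (r - 2))"
      using square_le_one_plus_powr[of s r] r c that by (intro mult_left_mono) auto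
    moreover have "c * s powr (r - 2) \<le> \<delta> * s powr (r - 2)"
      using c by (intro mult_right_mono) auto
    ultimately have "0 \<le> (1 - c) - c * s\<^sup>2 + \<delta> * s powr (r - 2)"
      using c by (simp add: algebra_simps)
    then have "0 \<le> s * ((1 - c) - c * s\<^sup>2 + \<delta> * s powr (r - 2))" using that by simp
    also have "s * s powr (r - 2) = s powr (r - 1)"
      using powr_add[of s 1 "r - 2"] that by (cases "s = 0") auto
    then have "s * ((1 - c) - c * s\<^sup>2 + \<delta> * s powr (r - 2)) = \<psi>1 s"
      by (simp add: \<psi>1_def algebra_simps power2_eq_square power3_eq_cube)
    finally show ?thesis .
  qed
  have "convex_on {0..} \<psi>"
  proof (rule convex_on_realI[where f' = \<psi>1])
    fix x y :: real assume xy: "x \<in> {0..}" "y \<in> {0..}" "x \<le> y"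
    \<comment> \<open>\<open>\<psi>1\<close> is differentiated only at positive points, where the real power is smooth; at \<open>0\<close>
      it vanishes, and it is nonnegative elsewhere.\<close>
    show "\<psi>1 x \<le> \<psi>1 y"
    proof (cases "x = 0")
      case True
      then show ?thesis using nonneg[of y] xy r by (simp add: \<psi>1_def)
    next
      case False
      then have "0 < x" using xy by simp
      show ?thesis by (rule DERIV_nonneg_imp_nondecreasing[OF xy(3)], rule d1) (use \<open>0 < x\<close> in simp)
    qed
  qed (auto simp: d0)
  moreover have "mono_on {0..} \<psi>"
  proof (rule mono_onI)
    fix x y :: real assume xy: "x \<in> {0..}" "y \<in> {0..}" "x \<le> y"
    show "\<psi> x \<le> \<psi> y"
    proof (rule DERIV_nonneg_imp_nondecreasing[OF xy(3)])
      fix z assume "x \<le> z"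
      then have "0 \<le> z" using xy by simp
      then show "\<exists>d. (\<psi> has_real_derivative d) (at z) \<and> 0 \<le> d" using d0 nonneg by blast
    qed
  qed
  ultimately have "convex_on UNIV (\<lambda>W::'a. \<psi> (norm W))" by (rule convex_on_radial)
  then show ?thesis
    by (simp add: \<psi>_def poly_kernel_def quartic_kernel_def algebra_simps diff_divide_distrib)
qed

lemma smooth_adaptable_if_quadratic_hessian:
  fixes F :: "'a::real_inner \<Rightarrow> real"
  assumes F: "quadratic_hessian C F" and "0 < \<delta>" "4 \<le> r"
  shows "smooth_adaptable (poly_kernel \<delta> r) F"
proof -
  define c where "c = min (1 / 4) (\<delta> / 3)"
  have c: "0 < c" "c \<le> 1 / 4" "3 * c \<le> \<delta>" using assms by (auto simp: c_def)
  define M where "M = max 1 C"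
  define L where "L = M / c"
  have L: "0 < L" "L * c = M" using c by (auto simp: L_def M_def)
  have *: "convex_on UNIV (\<lambda>W. L * poly_kernel \<delta> r W + G W)" if G: "quadratic_hessian C G" for G :: "'a \<Rightarrow> real"
  proof -
    have "convex_on UNIV (\<lambda>W::'a. L * (poly_kernel \<delta> r W - c * quartic_kernel W))"
      using L c assms by (intro convex_on_cmul poly_kernel_minus_quartic_kernel_convex) auto
    moreover have "convex_on UNIV (\<lambda>W. M * quartic_kernel W + G W)"
      by (rule quartic_kernel_dominates[OF G]) (simp add: M_def)
    ultimately have "convex_on UNIV (\<lambda>W. L * (poly_kernel \<delta> r W - c * quartic_kernel W) + (M * quartic_kernel W + G W))"
      by (rule convex_on_add)
    then show ?thesis by (simp add: right_diff_distrib L(2) flip: mult.assoc)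
  qed
  have "quadratic_hessian C (\<lambda>W. - F W)" using quadratic_hessian_cmult[OF F, of "-1"] by simp
  from *[OF this] *[OF F] L(1) show ?thesis unfolding smooth_adaptable_def by auto
qed

section \<open>Partial derivatives and derivatives along lines\<close>

lemma has_derivative_partial_deriv:
  fixes f :: "real ^ 'n::finite \<Rightarrow> 'b::real_normed_vector"
  assumes "f differentiable (at x)"
  shows "(f has_derivative (\<lambda>h. \<Sum>j\<in>UNIV. h $ j *\<^sub>R partial_deriv j f x)) (at x)"
    and "frechet_derivative f (at x) (axis j 1) = partial_deriv j f x"
proof -
  let ?D = "frechet_derivative f (at x)"
  have D: "(f has_derivative ?D) (at x)" using assms by (simp add: frechet_derivative_works)
  then interpret linear ?D by (rule has_derivative_linear)
  have part: "partial_deriv j f x = ?D (axis j 1)" for j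
  proof -
    have "((\<lambda>t. x + t *\<^sub>R axis j 1) has_derivative (\<lambda>t. t *\<^sub>R axis j 1)) (at (0::real))"
      by (auto intro!: derivative_eq_intros)
    from has_derivative_compose[OF this, of f ?D] D
    have "((\<lambda>t. f (x + t *\<^sub>R axis j 1)) has_derivative (\<lambda>t. t *\<^sub>R ?D (axis j 1))) (at 0)"
      by (simp add: scaleR)
    then show ?thesis unfolding partial_deriv_def
      by (intro vector_derivative_at) (simp add: has_vector_derivative_def)
  qed
  then show "?D (axis j 1) = partial_deriv j f x" by simp
  have "?D h = (\<Sum>j\<in>UNIV. h $ j *\<^sub>R partial_deriv j f x)" for h
  proof -
    have "?D h = ?D (\<Sum>j\<in>UNIV. h $ j *\<^sub>R axis j 1)"
      using basis_expansion[of h] by (simp add: scalar_mult_eq_scaleR)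
    then show ?thesis by (simp add: sum scaleR part)
  qed
  then have "?D = (\<lambda>h. \<Sum>j\<in>UNIV. h $ j *\<^sub>R partial_deriv j f x)" by auto
  then show "(f has_derivative (\<lambda>h. \<Sum>j\<in>UNIV. h $ j *\<^sub>R partial_deriv j f x)) (at x)"
    using D by simp
qed

lemma has_vector_derivative_line:
  fixes f :: "real ^ 'n::finite \<Rightarrow> 'b::real_normed_vector"
  assumes "f differentiable (at (x + t *\<^sub>R e))"
  shows "((\<lambda>t. f (x + t *\<^sub>R e)) has_vector_derivative
      (\<Sum>j\<in>UNIV. e $ j *\<^sub>R partial_deriv j f (x + t *\<^sub>R e))) (at t)"
proof -
  have "((\<lambda>t. x + t *\<^sub>R e) has_derivative (\<lambda>t. t *\<^sub>R e)) (at t)"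
    by (auto intro!: derivative_eq_intros)
  from has_derivative_compose[OF this has_derivative_partial_deriv(1)[OF assms]]
  show ?thesis by (simp add: has_vector_derivative_def scaleR_sum_right)
qed

lemma frechet_derivative_apply_differentiable:
  assumes "twice_differentiable f"
  shows "(\<lambda>y. frechet_derivative f (at y) h) differentiable (at x)"
proof -
  have "bounded_linear (frechet_derivative f (at y))" for y
    using assms by (metis twice_differentiable_def frechet_derivative_works has_derivative_bounded_linear)
  then have eq: "blinfun_apply (Blinfun (frechet_derivative f (at y))) h = frechet_derivative f (at y) h" for y
    by (simp add: bounded_linear_Blinfun_apply)
  have "(\<lambda>y. Blinfun (frechet_derivative f (at y))) differentiable (at x)"
    using assms by (simp add: twice_differentiable_def)
  then have "(\<lambda>y. blinfun_apply (Blinfun (frechet_derivative f (at y))) h) differentiable (at x)"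
    unfolding differentiable_def using blinfun.bounded_linear_left bounded_linear.has_derivative by blast
  then show ?thesis by (simp add: eq)
qed

lemma partial_deriv_differentiable:
  fixes f :: "real ^ 'n::finite \<Rightarrow> 'b::real_normed_vector"
  assumes "twice_differentiable f"
  shows "partial_deriv j f differentiable (at x)"
proof -
  have "partial_deriv j f = (\<lambda>y. frechet_derivative f (at y) (axis j 1))"
    using assms by (auto simp: twice_differentiable_def has_derivative_partial_deriv(2))
  then show ?thesis using frechet_derivative_apply_differentiable[OF assms] by simp
qed

lemma twice_differentiable_real:
  fixes \<sigma> :: "real \<Rightarrow> real"
  assumes "twice_differentiable \<sigma>"
  shows "(\<sigma> has_real_derivative deriv \<sigma> x) (at x)"
    and "(deriv \<sigma> has_real_derivative deriv (deriv \<sigma>) x) (at x)"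
proof -
  have d: "\<sigma> differentiable (at y)" for y using assms by (simp add: twice_differentiable_def)
  then show 1: "(\<sigma> has_real_derivative deriv \<sigma> x) (at x)" for x
    by (simp add: DERIV_deriv_iff_real_differentiable)
  have "frechet_derivative \<sigma> (at y) 1 = deriv \<sigma> y" for y
    using frechet_derivative_at[OF 1[of y, unfolded has_field_derivative_def]] by (metis mult.right_neutral)
  then have "deriv \<sigma> differentiable (at x)"
    using frechet_derivative_apply_differentiable[OF assms, of 1 x] by simp
  then show "(deriv \<sigma> has_real_derivative deriv (deriv \<sigma>) x) (at x)"
    by (simp add: DERIV_deriv_iff_real_differentiable)
qed

lemma bounded_range_norm: "bounded (range f) \<longleftrightarrow> (\<exists>B. \<forall>x. norm (f x) \<le> B)"
  by (auto simp: bounded_iff)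

text \<open>\<open>K\<close> bounds \<open>f\<close> and its first two derivatives along lines, relative to the length of the
  direction vector.\<close>

definition bounded_line_derivatives :: "real \<Rightarrow> ('a::real_normed_vector \<Rightarrow> real) \<Rightarrow> bool" where
  "bounded_line_derivatives K f \<longleftrightarrow>
     (\<forall>v e. \<exists>f1 f2. \<forall>t. ((\<lambda>t. f (v + t *\<^sub>R e)) has_real_derivative f1 t) (at t) \<and>
        (f1 has_real_derivative f2 t) (at t) \<and>
        \<bar>f (v + t *\<^sub>R e)\<bar> \<le> K \<and> \<bar>f1 t\<bar> \<le> K * norm e \<and> \<bar>f2 t\<bar> \<le> K * (norm e)\<^sup>2)"

lemma bounded_line_derivatives_if_bounded_partial_derivs:
  fixes g :: "real ^ 'n::finite \<Rightarrow> real ^ 'm::finite"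
  assumes tw: "twice_differentiable g" and b0: "bounded (range g)"
    and b1: "\<And>j. bounded (range (partial_deriv j g))"
    and b2: "\<And>j l. bounded (range (partial_deriv l (partial_deriv j g)))"
  obtains K where "0 \<le> K" "\<And>b. bounded_line_derivatives K (\<lambda>x. g x $ b)"
proof -
  obtain B0 where B0: "\<And>x. norm (g x) \<le> B0" using b0 by (auto simp: bounded_range_norm)
  obtain B1 where B1: "\<And>j x. norm (partial_deriv j g x) \<le> B1 j"
    using b1 unfolding bounded_range_norm by metis
  have "\<forall>j l. \<exists>B. \<forall>x. norm (partial_deriv l (partial_deriv j g) x) \<le> B"
    using b2 by (simp add: bounded_range_norm)
  then obtain B2 where B2: "\<And>j l x. norm (partial_deriv l (partial_deriv j g) x) \<le> B2 j l"
    by metis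
  define K1 where "K1 = (\<Sum>j\<in>UNIV. B1 j)"
  define K2 where "K2 = (\<Sum>j\<in>UNIV. \<Sum>l\<in>UNIV. B2 j l)"
  define K where "K = B0 + K1 + K2"
  have nn: "0 \<le> B0" "\<And>j. 0 \<le> B1 j" "\<And>j l. 0 \<le> B2 j l"
    using B0 B1 B2 norm_ge_zero order_trans by blast+
  then have nn': "0 \<le> K1" "0 \<le> K2" by (auto simp: K1_def K2_def intro!: sum_nonneg)
  have dg: "g differentiable (at x)" for x using tw by (simp add: twice_differentiable_def)
  have "\<exists>\<gamma>1 \<gamma>2. \<forall>t.
      ((\<lambda>t. g (v + t *\<^sub>R e) $ b) has_real_derivative \<gamma>1 t) (at t) \<and>
      (\<gamma>1 has_real_derivative \<gamma>2 t) (at t) \<and>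
      \<bar>g (v + t *\<^sub>R e) $ b\<bar> \<le> K \<and> \<bar>\<gamma>1 t\<bar> \<le> K * norm e \<and> \<bar>\<gamma>2 t\<bar> \<le> K * (norm e)\<^sup>2" for b v e
  proof -
    define \<Gamma>1 where "\<Gamma>1 t = (\<Sum>j\<in>UNIV. e $ j *\<^sub>R partial_deriv j g (v + t *\<^sub>R e))" for t
    define \<Gamma>2 where "\<Gamma>2 t = (\<Sum>j\<in>UNIV. e $ j *\<^sub>R
        (\<Sum>l\<in>UNIV. e $ l *\<^sub>R partial_deriv l (partial_deriv j g) (v + t *\<^sub>R e)))" for t
    have "((\<lambda>t. g (v + t *\<^sub>R e)) has_vector_derivative \<Gamma>1 t) (at t)" for t
      unfolding \<Gamma>1_def by (rule has_vector_derivative_line[OF dg])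
    then have 1: "((\<lambda>t. g (v + t *\<^sub>R e) $ b) has_real_derivative \<Gamma>1 t $ b) (at t)" for t
      unfolding has_real_derivative_iff_has_vector_derivative
      by (rule bounded_linear.has_vector_derivative[OF bounded_linear_vec_nth])
    have "(\<Gamma>1 has_vector_derivative \<Gamma>2 t) (at t)" for t
      unfolding \<Gamma>1_def \<Gamma>2_def
      by (intro has_vector_derivative_sum bounded_linear.has_vector_derivative[OF bounded_linear_scaleR_right]
          has_vector_derivative_line partial_deriv_differentiable[OF tw])
    then have 2: "((\<lambda>t. \<Gamma>1 t $ b) has_real_derivative \<Gamma>2 t $ b) (at t)" for t
      unfolding has_real_derivative_iff_has_vector_derivative
      by (rule bounded_linear.has_vector_derivative[OF bounded_linear_vec_nth])
    have e: "\<bar>e $ j\<bar> \<le> norm e" for j by (rule component_le_norm_cart)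
    have "norm (\<Gamma>1 t) \<le> K1 * norm e" for t
      unfolding \<Gamma>1_def K1_def sum_distrib_right
    proof (rule sum_norm_le)
      fix j
      have "\<bar>e $ j\<bar> * norm (partial_deriv j g (v + t *\<^sub>R e)) \<le> norm e * B1 j"
        by (intro mult_mono e B1) auto
      then show "norm (e $ j *\<^sub>R partial_deriv j g (v + t *\<^sub>R e)) \<le> B1 j * norm e"
        by (simp add: mult.commute)
    qed
    then have "\<bar>\<Gamma>1 t $ b\<bar> \<le> K1 * norm e" for t
      using component_le_norm_cart[of "\<Gamma>1 t" b] order_trans by blast
    moreover have "K1 * norm e \<le> K * norm e"
      using nn nn' by (intro mult_right_mono) (auto simp: K_def)
    ultimately have 3: "\<bar>\<Gamma>1 t $ b\<bar> \<le> K * norm e" for t using order_trans by blast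
    have "norm (\<Gamma>2 t) \<le> K2 * (norm e)\<^sup>2" for t
      unfolding \<Gamma>2_def K2_def sum_distrib_right scaleR_sum_right
    proof (intro sum_norm_le)
      fix j l
      have "\<bar>e $ j\<bar> * (\<bar>e $ l\<bar> * norm (partial_deriv l (partial_deriv j g) (v + t *\<^sub>R e)))
          \<le> norm e * (norm e * B2 j l)"
        by (intro mult_mono e B2) auto
      then show "norm (e $ j *\<^sub>R e $ l *\<^sub>R partial_deriv l (partial_deriv j g) (v + t *\<^sub>R e))
          \<le> B2 j l * (norm e)\<^sup>2"
        by (simp add: abs_mult power2_eq_square mult_ac)
    qed
    then have "\<bar>\<Gamma>2 t $ b\<bar> \<le> K2 * (norm e)\<^sup>2" for t
      using component_le_norm_cart[of "\<Gamma>2 t" b] order_trans by blast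
    moreover have "K2 * (norm e)\<^sup>2 \<le> K * (norm e)\<^sup>2"
      using nn nn' by (intro mult_right_mono) (auto simp: K_def)
    ultimately have 4: "\<bar>\<Gamma>2 t $ b\<bar> \<le> K * (norm e)\<^sup>2" for t using order_trans by blast
    have "\<bar>g x $ b\<bar> \<le> K" for x
      using component_le_norm_cart[of "g x" b] B0[of x] nn' by (simp add: K_def)
    with 1 2 3 4 show ?thesis
      by (intro exI[of _ "\<lambda>t. \<Gamma>1 t $ b"] exI[of _ "\<lambda>t. \<Gamma>2 t $ b"]) auto
  qed
  then show ?thesis
    using nn nn' by (intro that[of K]) (simp_all add: bounded_line_derivatives_def K_def)
qed

section \<open>The coordinates before activation\<close>

text \<open>\<open>s\<close> and its first two derivatives along lines grow at most affinely in \<open>\<bar>W\<bar>\<close>.\<close>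

definition affine_growth :: "real \<Rightarrow> ('a::real_normed_vector \<Rightarrow> real) \<Rightarrow> bool" where
  "affine_growth K s \<longleftrightarrow>
     (\<forall>W D. \<exists>s1 s2. \<forall>t. ((\<lambda>t. s (W + t *\<^sub>R D)) has_real_derivative s1 t) (at t) \<and>
        (s1 has_real_derivative s2 t) (at t) \<and>
        \<bar>s (W + t *\<^sub>R D)\<bar> \<le> K * (1 + norm (W + t *\<^sub>R D)) \<and>
        \<bar>s1 t\<bar> \<le> K * (1 + norm (W + t *\<^sub>R D)) * norm D \<and>
        \<bar>s2 t\<bar> \<le> K * (1 + norm (W + t *\<^sub>R D)) * (norm D)\<^sup>2)"

lemma affine_growth_sum:
  assumes "finite I" "\<And>i. i \<in> I \<Longrightarrow> affine_growth K (s i)"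
  shows "affine_growth (real (card I) * K) (\<lambda>W. \<Sum>i\<in>I. s i W)"
  unfolding affine_growth_def
proof (intro allI)
  fix W D
  have "\<forall>i\<in>I. \<exists>s1 s2. \<forall>t. ((\<lambda>t. s i (W + t *\<^sub>R D)) has_real_derivative s1 t) (at t) \<and>
        (s1 has_real_derivative s2 t) (at t) \<and>
        \<bar>s i (W + t *\<^sub>R D)\<bar> \<le> K * (1 + norm (W + t *\<^sub>R D)) \<and>
        \<bar>s1 t\<bar> \<le> K * (1 + norm (W + t *\<^sub>R D)) * norm D \<and>
        \<bar>s2 t\<bar> \<le> K * (1 + norm (W + t *\<^sub>R D)) * (norm D)\<^sup>2"
    using assms(2) unfolding affine_growth_def by blast
  then obtain s1 s2 where s:
    "\<And>i t. i \<in> I \<Longrightarrow> ((\<lambda>t. s i (W + t *\<^sub>R D)) has_real_derivative s1 i t) (at t)"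
    "\<And>i t. i \<in> I \<Longrightarrow> (s1 i has_real_derivative s2 i t) (at t)"
    "\<And>i t. i \<in> I \<Longrightarrow> \<bar>s i (W + t *\<^sub>R D)\<bar> \<le> K * (1 + norm (W + t *\<^sub>R D))"
    "\<And>i t. i \<in> I \<Longrightarrow> \<bar>s1 i t\<bar> \<le> K * (1 + norm (W + t *\<^sub>R D)) * norm D"
    "\<And>i t. i \<in> I \<Longrightarrow> \<bar>s2 i t\<bar> \<le> K * (1 + norm (W + t *\<^sub>R D)) * (norm D)\<^sup>2"
    by metis
  have sum_le: "\<bar>\<Sum>i\<in>I. f i\<bar> \<le> real (card I) * C" if "\<And>i. i \<in> I \<Longrightarrow> \<bar>f i\<bar> \<le> C" for f and C :: real
    using order_trans[OF sum_abs sum_bounded_above[of I "\<lambda>i. \<bar>f i\<bar>" C]] that by simp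
  show "\<exists>k1 k2. \<forall>t. ((\<lambda>t. \<Sum>i\<in>I. s i (W + t *\<^sub>R D)) has_real_derivative k1 t) (at t) \<and>
        (k1 has_real_derivative k2 t) (at t) \<and>
        \<bar>\<Sum>i\<in>I. s i (W + t *\<^sub>R D)\<bar> \<le> real (card I) * K * (1 + norm (W + t *\<^sub>R D)) \<and>
        \<bar>k1 t\<bar> \<le> real (card I) * K * (1 + norm (W + t *\<^sub>R D)) * norm D \<and>
        \<bar>k2 t\<bar> \<le> real (card I) * K * (1 + norm (W + t *\<^sub>R D)) * (norm D)\<^sup>2"
  proof (rule exI[of _ "\<lambda>t. \<Sum>i\<in>I. s1 i t"], rule exI[of _ "\<lambda>t. \<Sum>i\<in>I. s2 i t"],
      intro allI conjI)
  qed (use s in \<open>auto intro!: DERIV_sum sum_le simp: mult.assoc\<close>)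
qed

lemma norm_fst_snd_le:
  fixes W :: "'a::real_normed_vector \<times> 'b::real_normed_vector"
  shows "norm (fst W) \<le> norm W" "norm (snd W) \<le> norm W"
  by (metis norm_fst_le norm_snd_le prod.collapse)+

text \<open>The matrix entry contributes the growth, its derivative along a line is constant, and the
  second factor is bounded with its derivatives; the constant \<open>2 K\<close> covers the term \<open>2 u' \<gamma>'\<close> of
  the second derivative of the product.\<close>

lemma affine_growth_weight_times_feature:
  fixes g :: "real ^ 'n::finite \<Rightarrow> real ^ 'm::finite" and a :: "'k::finite" and b :: 'm
  assumes K: "0 \<le> K" and g: "bounded_line_derivatives K (\<lambda>x. g x $ b)"
  shows "affine_growth (2 * K)
     (\<lambda>W::(real ^ ('m \<times> 'k::finite)) \<times> (real ^ 'n). fst W $ (b, a) * g (snd W) $ b)"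
  unfolding affine_growth_def
proof (intro allI)
  fix W D :: "(real ^ ('m \<times> 'k::finite)) \<times> (real ^ 'n)"
  define u d where "u t = fst (W + t *\<^sub>R D) $ (b, a)" and "d = fst D $ (b, a)" for t
  define \<gamma> where "\<gamma> t = g (snd (W + t *\<^sub>R D)) $ b" for t
  have eq: "\<gamma> t = g (snd W + t *\<^sub>R snd D) $ b" for t by (simp add: \<gamma>_def)
  obtain \<gamma>1 \<gamma>2 where \<gamma>:
    "\<And>t. (\<gamma> has_real_derivative \<gamma>1 t) (at t)" "\<And>t. (\<gamma>1 has_real_derivative \<gamma>2 t) (at t)"
    "\<And>t. \<bar>\<gamma> t\<bar> \<le> K" "\<And>t. \<bar>\<gamma>1 t\<bar> \<le> K * norm (snd D)" "\<And>t. \<bar>\<gamma>2 t\<bar> \<le> K * (norm (snd D))\<^sup>2"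
    using g[unfolded bounded_line_derivatives_def, rule_format, of "snd W" "snd D"]
    unfolding eq[symmetric] by blast
  have D: "norm (snd D) \<le> norm D" "\<bar>d\<bar> \<le> norm D"
    using norm_fst_snd_le[of D] component_le_norm_cart[of "fst D" "(b, a)"]
    by (auto simp: d_def)
  have u: "\<bar>u t\<bar> \<le> norm (W + t *\<^sub>R D)" for t
    unfolding u_def by (rule order_trans[OF component_le_norm_cart norm_fst_snd_le(1)])
  have du: "(u has_real_derivative d) (at t)" for t
    unfolding u_def d_def by (auto intro!: derivative_eq_intros)
  have \<gamma>1: "\<bar>\<gamma>1 t\<bar> \<le> K * norm D" for t
    by (rule order_trans[OF \<gamma>(4)]) (intro mult_left_mono D K)
  have \<gamma>2: "\<bar>\<gamma>2 t\<bar> \<le> K * (norm D)\<^sup>2" for t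
    by (rule order_trans[OF \<gamma>(5)]) (intro mult_left_mono power_mono D K, simp)
  have bounds: "\<bar>u t * \<gamma> t\<bar> \<le> 2 * K * (1 + norm (W + t *\<^sub>R D))"
    "\<bar>d * \<gamma> t + u t * \<gamma>1 t\<bar> \<le> 2 * K * (1 + norm (W + t *\<^sub>R D)) * norm D"
    "\<bar>2 * (d * \<gamma>1 t) + u t * \<gamma>2 t\<bar> \<le> 2 * K * (1 + norm (W + t *\<^sub>R D)) * (norm D)\<^sup>2" for t
  proof -
    let ?w = "norm (W + t *\<^sub>R D)"
    have m: "\<bar>x * y\<bar> \<le> p * q" if "\<bar>x\<bar> \<le> p" "\<bar>y\<bar> \<le> q" for x y p q :: real
      unfolding abs_mult using that by (intro mult_mono) auto
    have nn: "0 \<le> ?w * K" "0 \<le> ?w * (K * norm D)" "0 \<le> ?w * (K * (norm D)\<^sup>2)"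
      "0 \<le> K * norm D" using K by auto
    show "\<bar>u t * \<gamma> t\<bar> \<le> 2 * K * (1 + ?w)"
      using m[OF u \<gamma>(3), of t t] nn K by (simp add: algebra_simps)
    show "\<bar>d * \<gamma> t + u t * \<gamma>1 t\<bar> \<le> 2 * K * (1 + ?w) * norm D"
      using m[OF D(2) \<gamma>(3), of t] m[OF u \<gamma>1, of t t] nn by (simp add: algebra_simps)
    show "\<bar>2 * (d * \<gamma>1 t) + u t * \<gamma>2 t\<bar> \<le> 2 * K * (1 + ?w) * (norm D)\<^sup>2"
      using m[OF D(2) \<gamma>1, of t] m[OF u \<gamma>2, of t t] nn
      by (simp add: algebra_simps power2_eq_square)
  qed
  show "\<exists>s1 s2. \<forall>t. ((\<lambda>t. fst (W + t *\<^sub>R D) $ (b, a) * g (snd (W + t *\<^sub>R D)) $ b) has_real_derivative s1 t) (at t) \<and>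
        (s1 has_real_derivative s2 t) (at t) \<and>
        \<bar>fst (W + t *\<^sub>R D) $ (b, a) * g (snd (W + t *\<^sub>R D)) $ b\<bar> \<le> 2 * K * (1 + norm (W + t *\<^sub>R D)) \<and>
        \<bar>s1 t\<bar> \<le> 2 * K * (1 + norm (W + t *\<^sub>R D)) * norm D \<and>
        \<bar>s2 t\<bar> \<le> 2 * K * (1 + norm (W + t *\<^sub>R D)) * (norm D)\<^sup>2"
    unfolding u_def[symmetric] \<gamma>_def[symmetric]
    by (intro exI[of _ "\<lambda>t. d * \<gamma> t + u t * \<gamma>1 t"] exI[of _ "\<lambda>t. 2 * (d * \<gamma>1 t) + u t * \<gamma>2 t"] allI conjI bounds)
       (auto intro!: derivative_eq_intros \<gamma> du simp: algebra_simps)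
qed

section \<open>The activated coordinates and the objective\<close>

lemma quadratic_hessian_activation_square:
  fixes \<sigma> :: "real \<Rightarrow> real"
  assumes \<sigma>: "twice_differentiable \<sigma>"
    and b1: "bounded (range (deriv \<sigma>))"
    and b2: "bounded (range (\<lambda>x. \<sigma> x * deriv (deriv \<sigma>) x))"
    and s: "affine_growth K s" and K: "0 \<le> K"
  shows "\<exists>C. quadratic_hessian C (\<lambda>W. (\<sigma> (s W))\<^sup>2)"
proof -
  obtain A where A: "\<And>x. \<bar>deriv \<sigma> x\<bar> \<le> A" using b1 by (auto simp: bounded_range_norm)
  obtain B where B: "\<And>x. \<bar>\<sigma> x * deriv (deriv \<sigma>) x\<bar> \<le> B" using b2 by (auto simp: bounded_range_norm)
  have nn: "0 \<le> A" "0 \<le> B" using A B abs_ge_zero order_trans by blast+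
  note d\<sigma> = twice_differentiable_real[OF \<sigma>]
  have grow: "\<bar>\<sigma> x\<bar> \<le> \<bar>\<sigma> 0\<bar> + A * \<bar>x\<bar>" for x
  proof -
    have "norm (\<sigma> x - \<sigma> 0) \<le> A * norm (x - 0)"
      by (rule field_differentiable_bound[of UNIV \<sigma> "deriv \<sigma>"]) (auto simp: d\<sigma> A)
    then show ?thesis by simp
  qed
  define P where "P = \<bar>\<sigma> 0\<bar> + A * K"
  define C where "C = 4 * (A\<^sup>2 + B) * K\<^sup>2 + 4 * (P * (A * K))"
  have "quadratic_hessian C (\<lambda>W. (\<sigma> (s W))\<^sup>2)"
    unfolding quadratic_hessian_def
  proof (intro allI)
    fix W D
    obtain s1 s2 where s':
      "\<And>t. ((\<lambda>t. s (W + t *\<^sub>R D)) has_real_derivative s1 t) (at t)"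
      "\<And>t. (s1 has_real_derivative s2 t) (at t)"
      "\<And>t. \<bar>s (W + t *\<^sub>R D)\<bar> \<le> K * (1 + norm (W + t *\<^sub>R D))"
      "\<And>t. \<bar>s1 t\<bar> \<le> K * (1 + norm (W + t *\<^sub>R D)) * norm D"
      "\<And>t. \<bar>s2 t\<bar> \<le> K * (1 + norm (W + t *\<^sub>R D)) * (norm D)\<^sup>2"
      using s unfolding affine_growth_def by metis
    define S where "S t = s (W + t *\<^sub>R D)" for t
    define f1 where "f1 t = 2 * (\<sigma> (S t) * deriv \<sigma> (S t) * s1 t)" for t
    define f2 where "f2 t = 2 * (((deriv \<sigma> (S t))\<^sup>2 + \<sigma> (S t) * deriv (deriv \<sigma>) (S t)) * (s1 t)\<^sup>2
        + \<sigma> (S t) * deriv \<sigma> (S t) * s2 t)" for t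
    have dS: "(S has_real_derivative s1 t) (at t)" for t unfolding S_def by (rule s')
    note c = DERIV_chain2[OF d\<sigma>(1) dS] DERIV_chain2[OF d\<sigma>(2) dS]
    have D1: "((\<lambda>t. (\<sigma> (S t))\<^sup>2) has_real_derivative f1 t) (at t)" for t
      unfolding f1_def by (auto intro!: derivative_eq_intros c)
    have D2: "(f1 has_real_derivative f2 t) (at t)" for t
      unfolding f1_def f2_def
      by (rule derivative_eq_intros c s'(2) refl | simp add: algebra_simps power2_eq_square)+
    have "\<bar>f2 t\<bar> \<le> C * (1 + (norm (W + t *\<^sub>R D))\<^sup>2) * (norm D)\<^sup>2" for t
    proof -
      define w where "w = norm (W + t *\<^sub>R D)"
      have w: "0 \<le> w" by (simp add: w_def)
      have add: "\<bar>2 * (x + y)\<bar> \<le> 2 * (p + q)" if "\<bar>x\<bar> \<le> p" "\<bar>y\<bar> \<le> q" for x y p q :: real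
        using that by (simp add: abs_le_iff)
      \<comment> \<open>The summands of \<open>f2\<close> are bounded by multiples of \<open>(1 + w)\<^sup>2 \<bar>D\<bar>\<^sup>2\<close>; in the second one, both
        \<open>\<sigma> (S t)\<close> and \<open>s2 t\<close> contribute a factor \<open>1 + w\<close>.\<close>
      have "(1 + w)\<^sup>2 \<le> 2 * (1 + w\<^sup>2)"
        using zero_le_power2[of "1 - w"] by (simp add: power2_eq_square algebra_simps)
      have "\<bar>\<sigma> (S t)\<bar> \<le> \<bar>\<sigma> 0\<bar> + A * (K * (1 + w))"
        by (rule order_trans[OF grow]) (use s'(3)[of t] nn in \<open>auto intro!: mult_left_mono simp: S_def w_def\<close>)
      also have "\<dots> \<le> P * (1 + w)"
        using w by (simp add: P_def algebra_simps)
      finally have \<sigma>S: "\<bar>\<sigma> (S t)\<bar> \<le> P * (1 + w)" .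
      have "\<bar>(deriv \<sigma> (S t))\<^sup>2\<bar> \<le> A\<^sup>2"
        using power_mono[OF A[of "S t"], of 2] by simp
      then have "\<bar>(deriv \<sigma> (S t))\<^sup>2 + \<sigma> (S t) * deriv (deriv \<sigma>) (S t)\<bar> \<le> A\<^sup>2 + B"
        using B[of "S t"] by linarith
      moreover have "(s1 t)\<^sup>2 \<le> (K * (1 + w) * norm D)\<^sup>2"
        using power_mono[OF s'(4)[of t], of 2] by (simp add: w_def)
      ultimately have "\<bar>((deriv \<sigma> (S t))\<^sup>2 + \<sigma> (S t) * deriv (deriv \<sigma>) (S t)) * (s1 t)\<^sup>2\<bar>
          \<le> (A\<^sup>2 + B) * (K * (1 + w) * norm D)\<^sup>2"
        unfolding abs_mult using nn by (intro mult_mono) auto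
      moreover have "\<bar>\<sigma> (S t) * deriv \<sigma> (S t) * s2 t\<bar> \<le> P * (1 + w) * A * (K * (1 + w) * (norm D)\<^sup>2)"
        unfolding abs_mult
      proof (intro mult_mono)
        have "0 \<le> P" using nn K by (simp add: P_def)
        then show "0 \<le> P * (1 + w)" using w by simp
        then show "0 \<le> P * (1 + w) * A" using nn by simp
      qed (use s'(5)[of t] \<sigma>S A[of "S t"] in \<open>simp_all add: w_def\<close>)
      ultimately have "\<bar>f2 t\<bar> \<le> 2 * ((A\<^sup>2 + B) * (K * (1 + w) * norm D)\<^sup>2 + P * (1 + w) * A * (K * (1 + w) * (norm D)\<^sup>2))"
        unfolding f2_def by (rule add)
      also have "\<dots> = C / 2 * (1 + w)\<^sup>2 * (norm D)\<^sup>2"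
        unfolding C_def by algebra
      also have "\<dots> \<le> C / 2 * (2 * (1 + w\<^sup>2)) * (norm D)\<^sup>2"
        using \<open>(1 + w)\<^sup>2 \<le> _\<close> nn K by (intro mult_right_mono mult_left_mono) (auto simp: C_def P_def)
      also have "\<dots> = C * (1 + w\<^sup>2) * (norm D)\<^sup>2"
        by (simp add: field_simps)
      finally show ?thesis by (simp add: w_def)
    qed
    with D1 D2 show "\<exists>f1 f2. \<forall>t. ((\<lambda>t. (\<sigma> (s (W + t *\<^sub>R D)))\<^sup>2) has_real_derivative f1 t) (at t) \<and>
        (f1 has_real_derivative f2 t) (at t) \<and>
        \<bar>f2 t\<bar> \<le> C * (1 + (norm (W + t *\<^sub>R D))\<^sup>2) * (norm D)\<^sup>2"
      unfolding S_def by blast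
  qed
  then show ?thesis ..
qed

lemma objective_eq:
  "objective N \<sigma> g lam2 W = (\<Sum>i\<in>{1..N}. \<Sum>a\<in>UNIV. 1 / 2 *
      (\<sigma> (\<Sum>b\<in>UNIV. fst W $ (b, a) * g i (snd W) $ b))\<^sup>2) + lam2 / 2 * (norm W)\<^sup>2"
proof -
  have "(norm (coordwise \<sigma> x))\<^sup>2 = (\<Sum>a\<in>UNIV. (\<sigma> (x $ a))\<^sup>2)" for x :: "real ^ 'c"
    by (simp add: norm_vec_def L2_set_def sum_nonneg coordwise_def)
  then show ?thesis
    by (cases W) (simp add: objective_def norm_Pair sum_nonneg matrix_vector_mult_def Mat_def sum_distrib_left)
qed

theorem proposition30:
  fixes \<sigma> :: "real \<Rightarrow> real"
    and g :: "nat \<Rightarrow> real ^ 'n::finite \<Rightarrow> real ^ 'm::finite"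
    and N :: nat
    and lam2 \<delta> r :: real
  assumes "lam2 \<ge> 0"
    and "twice_differentiable \<sigma>"
    and "bounded (range (deriv \<sigma>))"
    and "bounded (range (\<lambda>x. \<sigma> x * deriv (deriv \<sigma>) x))"
    and "\<And>i. i \<in> {1..N} \<Longrightarrow> twice_differentiable (g i)"
    and "\<And>i. i \<in> {1..N} \<Longrightarrow> bounded (range (g i))"
    and "\<And>i j. i \<in> {1..N} \<Longrightarrow> bounded (range (partial_deriv j (g i)))"
    and "\<And>i j l. i \<in> {1..N} \<Longrightarrow> bounded (range (partial_deriv l (partial_deriv j (g i))))"
    and "\<delta> > 0"
    and "r \<ge> 4"
  shows "smooth_adaptable (poly_kernel \<delta> r)
           (objective N \<sigma> g lam2 :: (real ^ ('m \<times> 'k::finite)) \<times> (real ^ 'n) \<Rightarrow> real)"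
proof -
  have "\<exists>C. quadratic_hessian C (\<lambda>W::(real ^ ('m \<times> 'k)) \<times> (real ^ 'n).
      1 / 2 * (\<sigma> (\<Sum>b\<in>UNIV. fst W $ (b, a) * g i (snd W) $ b))\<^sup>2)" if i: "i \<in> {1..N}" for i a
  proof -
    obtain K where K: "0 \<le> K" and g: "\<And>b. bounded_line_derivatives K (\<lambda>x. g i x $ b)"
      using bounded_line_derivatives_if_bounded_partial_derivs[OF assms(5-8)] i by blast
    have growth: "affine_growth (CARD('m) * (2 * K))
        (\<lambda>W::(real ^ ('m \<times> 'k)) \<times> (real ^ 'n). \<Sum>b\<in>UNIV. fst W $ (b, a) * g i (snd W) $ b)"
      by (rule affine_growth_sum[OF finite affine_growth_weight_times_feature[OF K g]])
    have "0 \<le> real CARD('m) * (2 * K)" using K by simp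
    from quadratic_hessian_activation_square[OF assms(2-4) growth this]
    obtain C where "quadratic_hessian C (\<lambda>W::(real ^ ('m \<times> 'k)) \<times> (real ^ 'n).
        (\<sigma> (\<Sum>b\<in>UNIV. fst W $ (b, a) * g i (snd W) $ b))\<^sup>2)" ..
    from quadratic_hessian_cmult[OF this, of "1 / 2"] show ?thesis by (rule exI)
  qed
  then have "\<exists>C. quadratic_hessian C (\<lambda>W::(real ^ ('m \<times> 'k)) \<times> (real ^ 'n).
      \<Sum>i\<in>{1..N}. \<Sum>a\<in>UNIV. 1 / 2 * (\<sigma> (\<Sum>b\<in>UNIV. fst W $ (b, a) * g i (snd W) $ b))\<^sup>2)"
    by (intro quadratic_hessian_sum finite finite_atLeastAtMost)
  then obtain C where C: "quadratic_hessian C (\<lambda>W::(real ^ ('m \<times> 'k)) \<times> (real ^ 'n).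
      \<Sum>i\<in>{1..N}. \<Sum>a\<in>UNIV. 1 / 2 * (\<sigma> (\<Sum>b\<in>UNIV. fst W $ (b, a) * g i (snd W) $ b))\<^sup>2)"
    ..
  have "quadratic_hessian (C + \<bar>lam2 / 2\<bar> * 2)
      (objective N \<sigma> g lam2 :: (real ^ ('m \<times> 'k)) \<times> (real ^ 'n) \<Rightarrow> real)"
    using quadratic_hessian_add[OF C quadratic_hessian_cmult[OF quadratic_hessian_norm_square, of "lam2 / 2"]]
    by (simp only: objective_eq[abs_def])
  then show ?thesis using assms(9,10) by (rule smooth_adaptable_if_quadratic_hessian)
qed

end
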